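(* Let $\{U^*(\cdot\,;C_1,\dots,C_k)\}$, $k<N$, be a $k$-parameter family of stationary solutions of $U_t+F(U)_x=S(U)H_x$, and consider the semi-discrete method $$\frac{dU_i}{dt}+\frac{1}{\Delta x}\left(\widehat{\mathcal F}_{i,i+1/2}-\widehat{\mathcal F}_{i,i-1/2}\right)=\big(S(U_i)-S(U_i^*(x_i))\big)H_x(x_i)$$ associated with this family as described in the context. Assume that the method is well-defined and that the stationary solutions of the family are smooth. Then: (i) The method has the order of accuracy of the reconstruction operator: if $\mathcal R$ has order $p$, then for every smooth solution $U(x,t)$ of $U_t+F(U)_x=S(U)H_x$, every $t$ and every point $\bar x$ at which $H$ is differentiable, if for each $\Delta x$ the mesh has $x_i=\bar x$ as a node and $U_i^*$, $\widehat{\mathcal F}_{i,i\pm1/2}$ are computed from the exact values $U_j=U(x_j,t)$, then $$\partial_tU(x_i,t)+\frac{1}{\Delta x}\left(\widehat{\mathcal F}_{i,i+1/2}-\widehat{\mathcal F}_{i,i-1/2}\right)-\big(S(U(x_i,t))-S(U_i^*(x_i))\big)H_x(x_i)=O(\Delta x^p)\quad\text{as }\Delta x\to0.$$ (ii) The method preserves all the stationary solutions of the family: for all parameters $C_1,\dots,C_k$, the vector of point values $\{U^*(x_i;C_1,\dots,C_k)\}$ is an equilibrium of the ODE system given by the method.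
   Context: Setting. $\Omega\subset\mathbb R^N$ is open, $F:\Omega\to\mathbb R^N$ (flux) and $S:\Omega\to\mathbb R^N$ are smooth, the Jacobian of $F$ has $N$ distinct real nonzero eigenvalues on $\Omega$, and $H:\mathbb R\to\mathbb R$ is continuous and a.e. differentiable (and differentiable at the nodes used). A stationary solution is a locally absolutely continuous function $U^*$ with values in $\Omega$ satisfying $\frac{d}{dx}F(U^*(x))=S(U^*(x))H_x(x)$ at every point where $H$ is differentiable. The members of the family are defined on all of $\mathbb R$. Mesh. Uniform nodes $x_j$ with step $\Delta x$. Reconstruction operator. Fix integers $r,s\ge0$ and a map $\mathcal R:(\mathbb R^N)^{r+s+1}\to\mathbb R^N$ with $\mathcal R(0,\dots,0)=0$. It has order of accuracy $p$ if, for every smooth $\mathbb R^N$-valued function $g$ and every point $x_i$ of its domain, $$\frac{1}{\Delta x}\Big(\mathcal R(g(x_{i-r}),\dots,g(x_{i+s}))-\mathcal R(g(x_{i-1-r}),\dots,g(x_{i-1+s}))\Big)=g'(x_i)+O(\Delta x^p)$$ as $\Delta x\to0$ with $x_i$ fixed. The method. A set of $k$ distinct component indices $\{j_1,\dots,j_k\}\subset\{1,\dots,N\}$ is fixed in advance. Given values $U_j\in\Omega$ at the nodes, for each $i$: (1) find $C_1^i,\dots,C_k^i$ such that $u^*_{j_l}(x_i;C_1^i,\dots,C_k^i)=u_{i,j_l}$ for $l=1,\dots,k$, where $u^*_j$ and $u_{i,j}$ denote the $j$-th components of $U^*$ and $U_i$; set $U_i^*(x)=U^*(x;C_1^i,\dots,C_k^i)$;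 (2) put $\mathcal F_j=F(U_j)-F(U_i^*(x_j))$ for $j=i-1-r,\dots,i+s$; (3) put $\widehat{\mathcal F}_{i,i+1/2}=\mathcal R(\mathcal F_{i-r},\dots,\mathcal F_{i+s})$ and $\widehat{\mathcal F}_{i,i-1/2}=\mathcal R(\mathcal F_{i-1-r},\dots,\mathcal F_{i-1+s})$. The method is well-defined if the system of equations in (1) has a unique solution $(C_1^i,\dots,C_k^i)$ for every $i$ (and every data considered). *)

theory Defs
  imports "HOL-Analysis.Analysis" "HOL-Library.Landau_Symbols"
begin

(* Intended for open S only: derivatives are taken in full neighbourhoods. *)
primrec Ck_on :: "nat \<Rightarrow> 'a::real_normed_vector set \<Rightarrow> ('a \<Rightarrow> 'b::real_normed_vector) \<Rightarrow> bool" where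
  "Ck_on 0 S f \<longleftrightarrow> continuous_on S f"
| "Ck_on (Suc n) S f \<longleftrightarrow> (\<forall>x\<in>S. f differentiable (at x)) \<and>
     (\<forall>v. Ck_on n S (\<lambda>x. frechet_derivative f (at x) v))"

definition smooth_on :: "'a::real_normed_vector set \<Rightarrow> ('a \<Rightarrow> 'b::real_normed_vector) \<Rightarrow> bool" where
  "smooth_on S f \<longleftrightarrow> (\<forall>n. Ck_on n S f)"

definition absolutely_continuous_on :: "real set \<Rightarrow> (real \<Rightarrow> 'b::real_normed_vector) \<Rightarrow> bool" where
  "absolutely_continuous_on S f \<longleftrightarrow>
     (\<forall>\<epsilon>>0. \<exists>\<delta>>0. \<forall>(n::nat) a b.
        (\<forall>i<n. a i \<le> b i \<and> {a i..b i} \<subseteq> S) \<longrightarrow>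
        (\<forall>i<n. \<forall>j<n. i \<noteq> j \<longrightarrow> {a i<..<b i} \<inter> {a j<..<b j} = {}) \<longrightarrow>
        (\<Sum>i<n. b i - a i) < \<delta> \<longrightarrow>
        (\<Sum>i<n. norm (f (b i) - f (a i))) < \<epsilon>)"

definition locally_absolutely_continuous :: "(real \<Rightarrow> 'b::real_normed_vector) \<Rightarrow> bool" where
  "locally_absolutely_continuous f \<longleftrightarrow> (\<forall>a b. absolutely_continuous_on {a..b} f)"

definition real_eigenvalues :: "real^'n^'n \<Rightarrow> real set" where
  "real_eigenvalues A = {c. \<exists>v. v \<noteq> 0 \<and> A *v v = c *\<^sub>R v}"

definition stationary_solution ::
  "(real^'n) set \<Rightarrow> (real^'n \<Rightarrow> real^'n) \<Rightarrow> (real^'n \<Rightarrow> real^'n) \<Rightarrow> (real \<Rightarrow> real) \<Rightarrow>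
   (real \<Rightarrow> real^'n) \<Rightarrow> bool" where
  "stationary_solution \<Omega> F S H W \<longleftrightarrow>
     range W \<subseteq> \<Omega> \<and> locally_absolutely_continuous W \<and>
     (\<forall>x. H differentiable (at x) \<longrightarrow>
        ((\<lambda>y. F (W y)) has_vector_derivative deriv H x *\<^sub>R S (W x)) (at x))"

(* Smooth solutions U x t for x on the whole line and t in the open set T. As for stationary
   solutions, the equation is imposed wherever H is differentiable. *)
definition smooth_solution ::
  "(real^'n) set \<Rightarrow> (real^'n \<Rightarrow> real^'n) \<Rightarrow> (real^'n \<Rightarrow> real^'n) \<Rightarrow> (real \<Rightarrow> real) \<Rightarrow>
   real set \<Rightarrow> (real \<Rightarrow> real \<Rightarrow> real^'n) \<Rightarrow> bool" where
  "smooth_solution \<Omega> F S H T U \<longleftrightarrow>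
     (\<forall>x. \<forall>t\<in>T. U x t \<in> \<Omega>) \<and>
     smooth_on (UNIV \<times> T) (\<lambda>(x, t). U x t) \<and>
     (\<forall>x. \<forall>t\<in>T. H differentiable (at x) \<longrightarrow>
        vector_derivative (\<lambda>\<tau>. U x \<tau>) (at t) + vector_derivative (\<lambda>y. F (U y t)) (at x)
          = deriv H x *\<^sub>R S (U x t))"

definition node :: "real \<Rightarrow> real \<Rightarrow> int \<Rightarrow> real" where
  "node a h j = a + of_int j * h"

(* A reconstruction operator R acts on lists; only its values on lists of length r + s + 1 are
   ever used. stencil r s G i is the list G (i - r), ..., G (i + s). *)
definition stencil :: "nat \<Rightarrow> nat \<Rightarrow> (int \<Rightarrow> 'a) \<Rightarrow> int \<Rightarrow> 'a list" where
  "stencil r s G i = map G [i - int r..i + int s]"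

definition has_order_of_accuracy ::
  "((real^'n) list \<Rightarrow> real^'n) \<Rightarrow> nat \<Rightarrow> nat \<Rightarrow> nat \<Rightarrow> bool" where
  "has_order_of_accuracy R r s p \<longleftrightarrow>
     (\<forall>D g x. open D \<longrightarrow> smooth_on D g \<longrightarrow> x \<in> D \<longrightarrow>
        (\<lambda>h. norm ((1 / h) *\<^sub>R (R (stencil r s (\<lambda>j. g (node x h j)) 0)
                              - R (stencil r s (\<lambda>j. g (node x h j)) (- 1)))
                   - vector_derivative g (at x)))
        \<in> O[at_right 0](\<lambda>h. h ^ p))"

(* In what follows Us C is the family member with parameters C, P the set of admissible
   parameters, J l the l-th prescribed component, xs the nodes and V the nodal values. *)
definition matches ::
  "(real^'k) set \<Rightarrow> (real^'k \<Rightarrow> real \<Rightarrow> real^'n) \<Rightarrow> ('k \<Rightarrow> 'n) \<Rightarrow>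
   (int \<Rightarrow> real) \<Rightarrow> (int \<Rightarrow> real^'n) \<Rightarrow> int \<Rightarrow> real^'k \<Rightarrow> bool" where
  "matches P Us J xs V i C \<longleftrightarrow> C \<in> P \<and> (\<forall>l. Us C (xs i) $ J l = V i $ J l)"

definition method_well_defined ::
  "(real^'k) set \<Rightarrow> (real^'k \<Rightarrow> real \<Rightarrow> real^'n) \<Rightarrow> ('k \<Rightarrow> 'n) \<Rightarrow>
   (int \<Rightarrow> real) \<Rightarrow> (int \<Rightarrow> real^'n) \<Rightarrow> bool" where
  "method_well_defined P Us J xs V \<longleftrightarrow> (\<forall>i. \<exists>!C. matches P Us J xs V i C)"

definition local_stationary ::
  "(real^'k) set \<Rightarrow> (real^'k \<Rightarrow> real \<Rightarrow> real^'n) \<Rightarrow> ('k \<Rightarrow> 'n) \<Rightarrow>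
   (int \<Rightarrow> real) \<Rightarrow> (int \<Rightarrow> real^'n) \<Rightarrow> int \<Rightarrow> real \<Rightarrow> real^'n" where
  "local_stationary P Us J xs V i = Us (THE C. matches P Us J xs V i C)"

definition fluctuation ::
  "(real^'n \<Rightarrow> real^'n) \<Rightarrow>
   (real^'k) set \<Rightarrow> (real^'k \<Rightarrow> real \<Rightarrow> real^'n) \<Rightarrow> ('k \<Rightarrow> 'n) \<Rightarrow>
   (int \<Rightarrow> real) \<Rightarrow> (int \<Rightarrow> real^'n) \<Rightarrow> int \<Rightarrow> int \<Rightarrow> real^'n" where
  "fluctuation F P Us J xs V i j = F (V j) - F (local_stationary P Us J xs V i (xs j))"

definition flux_right ::
  "((real^'n) list \<Rightarrow> real^'n) \<Rightarrow> nat \<Rightarrow> nat \<Rightarrow> (real^'n \<Rightarrow> real^'n) \<Rightarrow>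
   (real^'k) set \<Rightarrow> (real^'k \<Rightarrow> real \<Rightarrow> real^'n) \<Rightarrow> ('k \<Rightarrow> 'n) \<Rightarrow>
   (int \<Rightarrow> real) \<Rightarrow> (int \<Rightarrow> real^'n) \<Rightarrow> int \<Rightarrow> real^'n" where
  "flux_right R r s F P Us J xs V i = R (stencil r s (fluctuation F P Us J xs V i) i)"

definition flux_left ::
  "((real^'n) list \<Rightarrow> real^'n) \<Rightarrow> nat \<Rightarrow> nat \<Rightarrow> (real^'n \<Rightarrow> real^'n) \<Rightarrow>
   (real^'k) set \<Rightarrow> (real^'k \<Rightarrow> real \<Rightarrow> real^'n) \<Rightarrow> ('k \<Rightarrow> 'n) \<Rightarrow>
   (int \<Rightarrow> real) \<Rightarrow> (int \<Rightarrow> real^'n) \<Rightarrow> int \<Rightarrow> real^'n" where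
  "flux_left R r s F P Us J xs V i = R (stencil r s (fluctuation F P Us J xs V i) (i - 1))"

definition method_source ::
  "(real^'n \<Rightarrow> real^'n) \<Rightarrow> (real \<Rightarrow> real) \<Rightarrow>
   (real^'k) set \<Rightarrow> (real^'k \<Rightarrow> real \<Rightarrow> real^'n) \<Rightarrow> ('k \<Rightarrow> 'n) \<Rightarrow>
   (int \<Rightarrow> real) \<Rightarrow> (int \<Rightarrow> real^'n) \<Rightarrow> int \<Rightarrow> real^'n" where
  "method_source S H P Us J xs V i =
     deriv H (xs i) *\<^sub>R (S (V i) - S (local_stationary P Us J xs V i (xs i)))"

definition method_rhs ::
  "((real^'n) list \<Rightarrow> real^'n) \<Rightarrow> nat \<Rightarrow> nat \<Rightarrow> (real^'n \<Rightarrow> real^'n) \<Rightarrow> (real^'n \<Rightarrow> real^'n) \<Rightarrow>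
   (real \<Rightarrow> real) \<Rightarrow> (real^'k) set \<Rightarrow> (real^'k \<Rightarrow> real \<Rightarrow> real^'n) \<Rightarrow> ('k \<Rightarrow> 'n) \<Rightarrow>
   real \<Rightarrow> (int \<Rightarrow> real) \<Rightarrow> (int \<Rightarrow> real^'n) \<Rightarrow> int \<Rightarrow> real^'n" where
  "method_rhs R r s F S H P Us J h xs V i =
     method_source S H P Us J xs V i
     - (1 / h) *\<^sub>R (flux_right R r s F P Us J xs V i - flux_left R r s F P Us J xs V i)"

(* V is an equilibrium of the ODE system dV/dt = rhs V. *)
definition equilibrium :: "(('i \<Rightarrow> 'a::zero) \<Rightarrow> ('i \<Rightarrow> 'a)) \<Rightarrow> ('i \<Rightarrow> 'a) \<Rightarrow> bool" where
  "equilibrium rhs V \<longleftrightarrow> (\<forall>i. rhs V i = 0)"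

end

theory Submission
  imports Defs
begin

text \<open>At a fixed point the parameters of the local stationary solution depend only on the
  exact solution at that point, not on the mesh step. Hence all fluctuations are samples of one
  smooth function, the difference of the fluxes of the exact and of the local stationary solution,
  to which the reconstruction operator is applied; the difference of the two differential
  equations identifies its derivative.\<close>

section \<open>Calculus of \<open>Ck_on\<close> and \<open>smooth_on\<close> on open sets\<close>

lemma Ck_on_cong:
  assumes "open S" "\<And>x. x \<in> S \<Longrightarrow> f x = g x" "Ck_on n S f"
  shows "Ck_on n S g"
  using assms(2,3)
proof (induction n arbitrary: f g)
  case 0
  then show ?case by (simp cong: continuous_on_cong)
next
  case (Suc n)
  \<comment> \<open>As \<open>S\<close> is open, \<open>f\<close> and \<open>g\<close> agree near
    \<open>x\<close>, so the derivative of \<open>f\<close> there is also that of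
    \<open>g\<close>.\<close>
  have D: "(g has_derivative frechet_derivative f (at x)) (at x)" if "x \<in> S" for x
    using has_derivative_transform_within_open[OF _ assms(1) that Suc.prems(1)]
      Suc.prems(2) that frechet_derivative_works by fastforce
  have "Ck_on n S (\<lambda>x. frechet_derivative g (at x) v)" for v
    using Suc.IH[of "\<lambda>x. frechet_derivative f (at x) v" "\<lambda>x. frechet_derivative g (at x) v"]
      Suc.prems(2) frechet_derivative_at[OF D] by simp
  then show ?case using D by (auto simp: differentiable_def)
qed

text \<open>A derivative known in closed form may replace \<open>frechet_derivative\<close>:
  derivatives are unique, so the two agree on \<open>S\<close>, and \<open>Ck_on_cong\<close>
  transfers the regularity.\<close>

lemma Ck_on_SucI:
  assumes "open S" "\<And>x. x \<in> S \<Longrightarrow> (f has_derivative f' x) (at x)"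
    and "\<And>v. Ck_on n S (\<lambda>x. f' x v)"
  shows "Ck_on (Suc n) S f"
proof -
  have "Ck_on n S (\<lambda>x. frechet_derivative f (at x) v)" for v
    by (rule Ck_on_cong[OF assms(1) _ assms(3)[of v]])
      (simp add: frechet_derivative_at[OF assms(2), symmetric])
  then show ?thesis using assms(2) by (auto simp: differentiable_def)
qed

text \<open>At the bottom this is continuity of differentiable maps; above it the induction
  hypothesis applies to each directional derivative.\<close>

lemma Ck_on_SucD:
  assumes "Ck_on (Suc n) S f"
  shows "Ck_on n S f"
  using assms
proof (induction n arbitrary: f)
  case 0
  then show ?case
    by (auto intro!: continuous_at_imp_continuous_on differentiable_imp_continuous_within)
next
  case (Suc n)
  then show ?case by (metis Ck_on.simps(2))
qed

lemma Ck_on_Suc_has_derivative: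
  assumes "Ck_on (Suc n) S f" "x \<in> S"
  shows "(f has_derivative frechet_derivative f (at x)) (at x)"
  using assms frechet_derivative_works by auto

lemma Ck_on_const:
  assumes "open S"
  shows "Ck_on n S (\<lambda>x. c)"
proof (induction n arbitrary: c)
  case (Suc n)
  show ?case by (rule Ck_on_SucI[OF assms has_derivative_const]) (rule Suc)
qed simp

lemma Ck_on_add:
  assumes "open S" "Ck_on n S f" "Ck_on n S g"
  shows "Ck_on n S (\<lambda>x. f x + g x)"
  using assms(2,3)
proof (induction n arbitrary: f g)
  case 0
  then show ?case by (simp add: continuous_on_add)
next
  case (Suc n)
  show ?case
    by (rule Ck_on_SucI[OF assms(1) has_derivative_add[OF
          Ck_on_Suc_has_derivative[OF Suc.prems(1)] Ck_on_Suc_has_derivative[OF Suc.prems(2)]]])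
      (use Suc in auto)
qed

lemma Ck_on_sum:
  assumes "open S" "finite I" "\<And>i. i \<in> I \<Longrightarrow> Ck_on n S (f i)"
  shows "Ck_on n S (\<lambda>x. \<Sum>i\<in>I. f i x)"
  using assms(2,3)
  by (induction I rule: finite_induct) (auto intro: Ck_on_const Ck_on_add assms(1))

lemma Ck_on_bounded_linear:
  assumes "open S" "bounded_linear L" "Ck_on n S f"
  shows "Ck_on n S (\<lambda>x. L (f x))"
  using assms(3)
proof (induction n arbitrary: f)
  case 0
  then show ?case using assms(2) by (simp add: bounded_linear.continuous_on)
next
  case (Suc n)
  show ?case
    by (rule Ck_on_SucI[OF assms(1) bounded_linear.has_derivative[OF assms(2)
          Ck_on_Suc_has_derivative[OF Suc.prems]]])
      (use Suc in auto)
qed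

lemma Ck_on_scaleR:
  fixes f :: "'a::real_normed_vector \<Rightarrow> real"
  assumes "open S" "Ck_on n S f" "Ck_on n S g"
  shows "Ck_on n S (\<lambda>x. f x *\<^sub>R g x)"
  using assms(2,3)
proof (induction n arbitrary: f g)
  case 0
  then show ?case by (simp add: continuous_on_scaleR)
next
  case (Suc n)
  show ?case
    by (rule Ck_on_SucI[OF assms(1) has_derivative_scaleR[OF
          Ck_on_Suc_has_derivative[OF Suc.prems(1)] Ck_on_Suc_has_derivative[OF Suc.prems(2)]]])
      \<comment> \<open>The product rule leaves one factor undifferentiated in each term; that
        factor has order \<open>Suc n\<close> and is lowered to \<open>n\<close> before the
        induction hypothesis applies.\<close>
      (use Suc Ck_on_SucD[OF Suc.prems(1)] Ck_on_SucD[OF Suc.prems(2)] in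
        \<open>auto intro!: Ck_on_add assms(1)\<close>)
qed

text \<open>In the chain rule the direction \<open>?g' x v\<close> varies with \<open>x\<close>,
  whereas \<open>Ck_on\<close> controls derivatives in fixed directions only. Expanding that
  direction in the finite basis of the codomain of \<open>g\<close> turns the derivative into a sum
  of scalar coefficients times derivatives of \<open>f\<close> in fixed directions.\<close>

lemma Ck_on_compose:
  fixes g :: "'a::real_normed_vector \<Rightarrow> 'b::euclidean_space"
  assumes "open A" "g ` A \<subseteq> B" "Ck_on n B f" "Ck_on n A g"
  shows "Ck_on n A (\<lambda>x. f (g x))"
  using assms(3,4)
proof (induction n arbitrary: f)
  case 0
  then show ?case using continuous_on_compose2[of B f A g] assms(2) by simp
next
  case (Suc n)
  let ?f' = "\<lambda>y. frechet_derivative f (at y)" and ?g' = "\<lambda>x. frechet_derivative g (at x)"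
  have f: "(f has_derivative ?f' (g x)) (at (g x))" if "x \<in> A" for x
    using Ck_on_Suc_has_derivative[OF Suc.prems(1)] assms(2) that by blast
  have D: "((\<lambda>x. f (g x)) has_derivative (\<lambda>v. \<Sum>b\<in>Basis. (?g' x v \<bullet> b) *\<^sub>R ?f' (g x) b)) (at x)"
    if "x \<in> A" for x
  proof -
    have "?f' (g x) (?g' x v) = (\<Sum>b\<in>Basis. (?g' x v \<bullet> b) *\<^sub>R ?f' (g x) b)" for v
      using linear_sum[OF has_derivative_linear[OF f[OF that]], of "\<lambda>b. (?g' x v \<bullet> b) *\<^sub>R b" Basis]
      by (simp add: linear_scale[OF has_derivative_linear[OF f[OF that]]] euclidean_representation)
    then show ?thesis
      using has_derivative_compose[OF Ck_on_Suc_has_derivative[OF Suc.prems(2) that] f[OF that]]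
      by simp
  qed
  have "Ck_on n A (\<lambda>x. ?g' x v \<bullet> b)" for v b
    using Suc.prems(2) by (intro Ck_on_bounded_linear[OF assms(1) bounded_linear_inner_left]) simp
  \<comment> \<open>This is again a composition with \<open>g\<close>, now with the outer map
    \<open>\<lambda>y. ?f' y b\<close>; hence the induction is general in \<open>f\<close>.\<close>
  moreover have "Ck_on n A (\<lambda>x. ?f' (g x) b)" for b
    using Suc.IH[of "\<lambda>y. ?f' y b"] Suc.prems(1) Ck_on_SucD[OF Suc.prems(2)] by simp
  ultimately have "Ck_on n A (\<lambda>x. \<Sum>b\<in>Basis. (?g' x v \<bullet> b) *\<^sub>R ?f' (g x) b)" for v
    by (intro Ck_on_sum[OF assms(1)] Ck_on_scaleR[OF assms(1)]) simp_all
  then show ?case using Ck_on_SucI[OF assms(1) D] by blast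
qed

lemma smooth_on_compose:
  fixes g :: "'a::real_normed_vector \<Rightarrow> 'b::euclidean_space"
  assumes "open A" "g ` A \<subseteq> B" "smooth_on B f" "smooth_on A g"
  shows "smooth_on A (\<lambda>x. f (g x))"
  using assms(3,4) Ck_on_compose[OF assms(1,2), of _ f] by (simp add: smooth_on_def)

lemma smooth_on_diff:
  assumes "open S" "smooth_on S f" "smooth_on S g"
  shows "smooth_on S (\<lambda>x. f x - g x)"
proof -
  have "Ck_on n S (\<lambda>x. f x + - g x)" for n
    using assms(2,3) Ck_on_bounded_linear[OF assms(1) bounded_linear_minus[OF bounded_linear_ident]]
    by (intro Ck_on_add assms(1)) (auto simp: smooth_on_def)
  then show ?thesis by (simp add: smooth_on_def)
qed

lemma smooth_on_imp_differentiable: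
  assumes "smooth_on S f" "x \<in> S"
  shows "f differentiable (at x)"
  using assms unfolding smooth_on_def by (auto dest: spec[of _ "Suc 0"])

text \<open>Used to freeze time: \<open>y \<mapsto> (y, t)\<close> embeds the line into space-time.
  Its derivative does not depend on the base point.\<close>

lemma smooth_on_Pair_const:
  fixes c :: "'b::real_normed_vector"
  assumes "open S"
  shows "smooth_on S (\<lambda>x::'a::real_normed_vector. (x, c))"
proof -
  have "Ck_on n S (\<lambda>x. (x, c))" for n
  proof (cases n)
    case 0
    then show ?thesis by (simp add: continuous_on_Pair)
  next
    case (Suc m)
    have "((\<lambda>x. (x, c)) has_derivative (\<lambda>v. (v, 0))) (at x)" for x
      by (rule has_derivative_Pair[OF has_derivative_ident has_derivative_const])
    then show ?thesis unfolding Suc by (rule Ck_on_SucI[OF assms]) (rule Ck_on_const[OF assms])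
  qed
  then show ?thesis by (simp add: smooth_on_def)
qed

lemma smooth_solution_imp_smooth_on_flux:
  assumes "smooth_on \<Omega> F" "smooth_solution \<Omega> F S H T U" "t \<in> T"
  shows "smooth_on UNIV (\<lambda>y. F (U y t))"
proof -
  have "smooth_on UNIV (\<lambda>y. U y t)"
    using smooth_on_compose[where f = "\<lambda>(x, t). U x t" and g = "\<lambda>y. (y, t)" and B = "UNIV \<times> T",
        OF open_UNIV _ _ smooth_on_Pair_const] assms(2,3)
    unfolding smooth_solution_def by auto
  then show ?thesis
    using assms unfolding smooth_solution_def by (intro smooth_on_compose[of UNIV _ \<Omega> F]) auto
qed

section \<open>Stencils, meshes and the fluxes of one cell\<close>

lemma stencil_shift: "stencil r s G (i + j) = stencil r s (\<lambda>m. G (i + m)) j"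
proof -
  have "map (\<lambda>m. i + m) [j - int r..j + int s] = [i + j - int r..i + j + int s]"
    by (rule nth_equalityI) (auto simp: nth_upto)
  then show ?thesis by (simp add: stencil_def flip: map_map[unfolded comp_def])
qed

lemma stencil_const: "stencil r s (\<lambda>_. c) i = replicate (r + s + 1) c"
  by (simp add: stencil_def map_replicate_const nat_add_distrib)

lemma node_shift: "node a h (i + j) = node (node a h i) h j"
  by (simp add: node_def algebra_simps)

text \<open>Uniqueness of the matching parameters makes the description operator return any
  \<open>C\<close> known to match.\<close>

lemma local_stationary_eqI:
  assumes "method_well_defined P Us J xs V" "matches P Us J xs V i C"
  shows "local_stationary P Us J xs V i = Us C"
  using assms unfolding method_well_defined_def local_stationary_def by (metis the_equality)

text \<open>Both fluxes of cell \<open>i\<close> subtract the same family member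
  \<open>Us C\<close>, so they reconstruct samples of one function. Recentring the mesh at node
  \<open>i\<close> moves their stencils to the indices \<open>0\<close> and \<open>- 1\<close>, the
  form in which \<open>has_order_of_accuracy\<close> is stated.\<close>

lemma flux_eq_stencil:
  assumes "method_well_defined P Us J (node a h) (\<lambda>j. W (node a h j))"
    and "matches P Us J (node a h) (\<lambda>j. W (node a h j)) i C"
  shows "flux_right R r s F P Us J (node a h) (\<lambda>j. W (node a h j)) i
      = R (stencil r s (\<lambda>j. F (W (node (node a h i) h j)) - F (Us C (node (node a h i) h j))) 0)"
    and "flux_left R r s F P Us J (node a h) (\<lambda>j. W (node a h j)) i
      = R (stencil r s (\<lambda>j. F (W (node (node a h i) h j)) - F (Us C (node (node a h i) h j))) (- 1))"
proof -
  have "(\<lambda>m. fluctuation F P Us J (node a h) (\<lambda>j. W (node a h j)) i (i + m))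
      = (\<lambda>j. F (W (node (node a h i) h j)) - F (Us C (node (node a h i) h j)))"
    by (simp add: fluctuation_def node_shift local_stationary_eqI[OF assms])
  then show "flux_right R r s F P Us J (node a h) (\<lambda>j. W (node a h j)) i
      = R (stencil r s (\<lambda>j. F (W (node (node a h i) h j)) - F (Us C (node (node a h i) h j))) 0)"
    and "flux_left R r s F P Us J (node a h) (\<lambda>j. W (node a h j)) i
      = R (stencil r s (\<lambda>j. F (W (node (node a h i) h j)) - F (Us C (node (node a h i) h j))) (- 1))"
    using stencil_shift[of r s "fluctuation F P Us J (node a h) (\<lambda>j. W (node a h j)) i" i 0]
      stencil_shift[of r s "fluctuation F P Us J (node a h) (\<lambda>j. W (node a h j)) i" i "- 1"]
    by (simp_all add: flux_right_def flux_left_def)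
qed

theorem mainTheorem3:
  fixes \<Omega> :: "(real^'n) set"
    and F S :: "real^'n \<Rightarrow> real^'n"
    and H :: "real \<Rightarrow> real"
    and R :: "(real^'n) list \<Rightarrow> real^'n"
    and r s :: nat
    and P :: "(real^'k) set"
    and Us :: "real^'k \<Rightarrow> real \<Rightarrow> real^'n"
    and J :: "'k \<Rightarrow> 'n"
  assumes "open \<Omega>"
    and "smooth_on \<Omega> F"
    and "smooth_on \<Omega> S"
    and "\<And>V. V \<in> \<Omega> \<Longrightarrow> card (real_eigenvalues (jacobian F (at V))) = CARD('n)"
    and "\<And>V. V \<in> \<Omega> \<Longrightarrow> 0 \<notin> real_eigenvalues (jacobian F (at V))"
    and "continuous_on UNIV H"
    and "AE x in lebesgue. H differentiable (at x)"
    and "R (replicate (r + s + 1) 0) = 0"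
    and "CARD('k) < CARD('n)"
    and "inj J"
    and "\<And>C. C \<in> P \<Longrightarrow> stationary_solution \<Omega> F S H (Us C)"
    and "\<And>C. C \<in> P \<Longrightarrow> smooth_on UNIV (Us C)"
  shows "(\<forall>(p::nat) T U t xb a i.
            has_order_of_accuracy R r s p \<longrightarrow>
            open T \<longrightarrow> smooth_solution \<Omega> F S H T U \<longrightarrow> t \<in> T \<longrightarrow>
            H differentiable (at xb) \<longrightarrow>
            (\<forall>h>0. node (a h) h (i h) = xb) \<longrightarrow>
            (\<forall>h>0. method_well_defined P Us J (node (a h) h) (\<lambda>j. U (node (a h) h j) t)) \<longrightarrow>
            (\<lambda>h. let xs = node (a h) h; V = (\<lambda>j. U (xs j) t) in
               norm (vector_derivative (\<lambda>\<tau>. U (xs (i h)) \<tau>) (at t)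
                     + (1 / h) *\<^sub>R (flux_right R r s F P Us J xs V (i h)
                                  - flux_left R r s F P Us J xs V (i h))
                     - method_source S H P Us J xs V (i h)))
            \<in> O[at_right 0](\<lambda>h. h ^ p))
       \<and>
         (\<forall>C a h.
            C \<in> P \<longrightarrow> h > 0 \<longrightarrow>
            (\<forall>j. H differentiable (at (node a h j))) \<longrightarrow>
            method_well_defined P Us J (node a h) (\<lambda>j. Us C (node a h j)) \<longrightarrow>
            equilibrium (method_rhs R r s F S H P Us J h (node a h)) (\<lambda>j. Us C (node a h j)))"
proof (intro conjI allI impI)
  fix p :: nat and T U t xb a i
  assume R: "has_order_of_accuracy R r s p"
    and U: "smooth_solution \<Omega> F S H T U" and t: "t \<in> T"
    and H: "H differentiable (at xb)"
    and nd: "\<forall>h>0. node (a h) h (i h) = xb"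
    and wd: "\<forall>h>0. method_well_defined P Us J (node (a h) h) (\<lambda>j. U (node (a h) h j) t)"
  \<comment> \<open>The cell index \<open>i h\<close> may vary with \<open>h\<close>, but its node
    is always \<open>xb\<close>; the right-hand side is therefore free of \<open>h\<close>.\<close>
  have m: "matches P Us J (node (a h) h) (\<lambda>j. U (node (a h) h j) t) (i h) C
      \<longleftrightarrow> C \<in> P \<and> (\<forall>l. Us C xb $ J l = U xb t $ J l)" if "h > 0" for h C
    using nd that by (simp add: matches_def)
  \<comment> \<open>The step \<open>1\<close> is an arbitrary positive choice: by \<open>m\<close>,
    parameters that match for one step match for all.\<close>
  obtain C where C: "C \<in> P" "\<forall>l. Us C xb $ J l = U xb t $ J l"
    using wd m[of 1] unfolding method_well_defined_def by (metis zero_less_one)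
  have st: "stationary_solution \<Omega> F S H (Us C)" and Us: "smooth_on UNIV (Us C)"
    using assms(11,12) C(1) by auto
  have smU: "smooth_on UNIV (\<lambda>y. F (U y t))"
    by (rule smooth_solution_imp_smooth_on_flux[OF assms(2) U t])
  have smC: "smooth_on UNIV (\<lambda>y. F (Us C y))"
    using st assms(2) Us unfolding stationary_solution_def
    by (intro smooth_on_compose[of UNIV _ \<Omega> F]) auto
  let ?g = "\<lambda>y. F (U y t) - F (Us C y)"
  have "((\<lambda>y. F (U y t)) has_vector_derivative vector_derivative (\<lambda>y. F (U y t)) (at xb)) (at xb)"
    using smooth_on_imp_differentiable[OF smU, of xb] by (simp add: vector_derivative_works)
  moreover have "((\<lambda>y. F (Us C y)) has_vector_derivative deriv H xb *\<^sub>R S (Us C xb)) (at xb)"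
    using st H unfolding stationary_solution_def by blast
  ultimately have "vector_derivative ?g (at xb)
      = vector_derivative (\<lambda>y. F (U y t)) (at xb) - deriv H xb *\<^sub>R S (Us C xb)"
    by (intro vector_derivative_at has_vector_derivative_diff)
  moreover have "vector_derivative (\<lambda>\<tau>. U xb \<tau>) (at t) + vector_derivative (\<lambda>y. F (U y t)) (at xb)
      = deriv H xb *\<^sub>R S (U xb t)"
    using U t H unfolding smooth_solution_def by blast
  \<comment> \<open>Subtracting the stationary equation from the evolution equation yields the
    source of the method minus the time derivative.\<close>
  ultimately have g': "vector_derivative ?g (at xb)
      = deriv H xb *\<^sub>R (S (U xb t) - S (Us C xb)) - vector_derivative (\<lambda>\<tau>. U xb \<tau>) (at t)"
    by (simp add: algebra_simps)
  let ?E = "\<lambda>h. norm ((1 / h) *\<^sub>R (R (stencil r s (\<lambda>j. ?g (node xb h j)) 0)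
      - R (stencil r s (\<lambda>j. ?g (node xb h j)) (- 1))) - vector_derivative ?g (at xb))"
  let ?L = "\<lambda>h. let xs = node (a h) h; V = (\<lambda>j. U (xs j) t) in
               norm (vector_derivative (\<lambda>\<tau>. U (xs (i h)) \<tau>) (at t)
                     + (1 / h) *\<^sub>R (flux_right R r s F P Us J xs V (i h)
                                  - flux_left R r s F P Us J xs V (i h))
                     - method_source S H P Us J xs V (i h))"
  have "?L h = ?E h" if "h > 0" for h
  proof -
    have w: "method_well_defined P Us J (node (a h) h) (\<lambda>j. U (node (a h) h j) t)"
      and n: "node (a h) h (i h) = xb"
      using wd nd that by auto
    have mC: "matches P Us J (node (a h) h) (\<lambda>j. U (node (a h) h j) t) (i h) C"
      using m[OF that] C by blast
    show ?thesis
      unfolding Let_def flux_eq_stencil[where W = "\<lambda>y. U y t", OF w mC] method_source_def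
        local_stationary_eqI[OF w mC] n g'
      \<comment> \<open>By \<open>g'\<close>, subtracting the derivative of \<open>?g\<close> adds
        the time derivative and removes the source, so the two residuals coincide exactly.\<close>
      by (rule arg_cong[where f = norm]) (simp add: algebra_simps)
  qed
  \<comment> \<open>The residuals are compared for positive \<open>h\<close> only, which is all that
    the filter \<open>at_right 0\<close> sees.\<close>
  then have "eventually (\<lambda>h. ?L h = ?E h) (at_right 0)"
    by (intro eventually_mono[OF eventually_at_right_less[of "0::real"]])
  moreover have "?E \<in> O[at_right 0](\<lambda>h. h ^ p)"
    by (rule R[unfolded has_order_of_accuracy_def, rule_format, OF open_UNIV
          smooth_on_diff[OF open_UNIV smU smC] UNIV_I])
  ultimately show "?L \<in> O[at_right 0](\<lambda>h. h ^ p)"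
    by (subst landau_o.big.in_cong)
next
  fix C a and h :: real
  assume "C \<in> P" and wd: "method_well_defined P Us J (node a h) (\<lambda>j. Us C (node a h j))"
  \<comment> \<open>The data are values of \<open>Us C\<close> itself, so \<open>C\<close> matches
    in every cell and well-definedness selects it everywhere. All fluctuations then vanish and the
    two source terms cancel.\<close>
  then have m: "matches P Us J (node a h) (\<lambda>j. Us C (node a h j)) i C" for i
    by (simp add: matches_def)
  show "equilibrium (method_rhs R r s F S H P Us J h (node a h)) (\<lambda>j. Us C (node a h j))"
    unfolding equilibrium_def method_rhs_def flux_eq_stencil[OF wd m] method_source_def
      local_stationary_eqI[OF wd m]
    \<comment> \<open>Both stencils are now constant zero lists of length \<open>r + s + 1\<close>,
      on which \<open>R\<close> vanishes; \<open>replicate\<close> stays folded to match that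
      assumption.\<close>
    using assms(8) by (simp add: stencil_const del: replicate.simps)
qed

end
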